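(* Let $H$ be an atomic monoid. Then: (1) $\mathsf c_{\mathrm{eq}}(a)\ge\mu_{\mathrm{eq}}(a)$ for all $a\in H$, and $\mathsf c_{\mathrm{eq}}(H)=\mu_{\mathrm{eq}}(H)$. (2) $\mathsf c_{\mathrm{eq}}(H)=\sup\{\mu_{\mathrm{eq}}(a): a\in H,\ \mathcal A_a(\sim_{H,\mathrm{eq}})\neq\emptyset,\ |\mathcal R_{a,k}|>1\text{ for some }k\in\mathsf L(a)\}=\sup\{k\in\mathbb N: a\in H,\ \mathcal A_a(\sim_{H,\mathrm{eq}})\neq\emptyset,\ k\in\mathsf L(a),\ |\mathcal R_{a,k}|>1\}$. (3) $\mathsf c_{\mathrm{adj}}(a)\ge\mu_{\mathrm{adj}}(a)$ for all $a\in H$, and $\mathsf c_{\mathrm{adj}}(H)=\mu_{\mathrm{adj}}(H)$. (4) $\mathsf c_{\mathrm{adj}}(H)=\sup\{\mu_{\mathrm{adj}}(a): a\in H,\ \mathcal A_a(\sim_{H,\mathrm{mon}})\neq\emptyset\}$. In particular, $\mathsf c_{\mathrm{mon}}(H)=\sup\big(\{\mu_{\mathrm{eq}}(a): a\in H,\ \mathcal A_a(\sim_{H,\mathrm{eq}})\neq\emptyset,\ |\mathcal R_{a,k}|>1\text{ for some }k\in\mathsf L(a)\}\cup\{\mu_{\mathrm{adj}}(a): a\in H,\ \mathcal A_a(\sim_{H,\mathrm{mon}})\neq\emptyset\}\big)$.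
   Context: A monoid is a commutative, cancellative semigroup with identity, written multiplicatively; $H^\times$ is its unit group, $H_{\mathrm{red}}=H/H^\times$, and $H$ is atomic if every non-unit is a product of atoms. $\mathsf Z(H)$ is the free abelian monoid with basis the set $\mathcal A(H_{\mathrm{red}})$ of atoms of $H_{\mathrm{red}}$, and $\pi_H:\mathsf Z(H)\to H_{\mathrm{red}}$ the homomorphism that is the identity on $\mathcal A(H_{\mathrm{red}})$. For $a\in H$: $\mathsf Z(a)=\pi_H^{-1}(aH^\times)$, $\mathsf L(a)=\{|z|:z\in\mathsf Z(a)\}$ ($|z|$ = length in the free monoid), $\mathsf Z_k(a)=\{z\in\mathsf Z(a):|z|=k\}$. For $z,z'\in\mathsf Z(H)$, $\mathsf d(z,z')=\max\{|z/\gcd(z,z')|,|z'/\gcd(z,z')|\}$; for $X,Y\subset\mathsf Z(H)$, $\mathsf d(X,Y)=\min\{\mathsf d(x,y):x\in X,y\in Y\}$. Lengths $k<l$ in $\mathsf L(a)$ are adjacent if $[k,l]\cap\mathsf L(a)=\{k,l\}$. The supremum of the empty set is $0$. Chains: for $N\in\mathbb N$, an $N$-chain concatenating $z_0,z_n\in\mathsf Z(a)$ is a sequence $z_0,\dots,z_n\in\mathsf Z(a)$ ($n\in\mathbb N$) with $\mathsf d(z_{i-1},z_i)\le N$ for all $i$; it is monotone if $|z_{i-1}|\le|z_i|$ for all $i$ and equal-length if $|z_{i-1}|=|z_i|$ for all $i$. $\mathsf c_{\mathrm{mon}}(a)$ (resp. $\mathsf c_{\mathrm{eq}}(a)$) is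 the smallest $N\in\mathbb N_0\cup\{\infty\}$ such that any $z,z'\in\mathsf Z(a)$ can be concatenated by a monotone (resp. equal-length) $N$-chain; $\mathsf c_{\mathrm{mon}}(H)=\sup_{a\in H}\mathsf c_{\mathrm{mon}}(a)$, $\mathsf c_{\mathrm{eq}}(H)=\sup_{a\in H}\mathsf c_{\mathrm{eq}}(a)$. The adjacent catenary degree is $\mathsf c_{\mathrm{adj}}(a)=\sup\{\mathsf d(\mathsf Z_k(a),\mathsf Z_l(a)):k,l\in\mathsf L(a)\text{ adjacent}\}$ and $\mathsf c_{\mathrm{adj}}(H)=\sup_{a\in H}\mathsf c_{\mathrm{adj}}(a)$. An equal-length $\mathcal R$-chain is a sequence $z_0,\dots,z_n\in\mathsf Z(a)$ with $\gcd(z_{i-1},z_i)\ne1$ and $|z_{i-1}|=|z_i|$ for all $i$; $z\approx_{\mathrm{eq}}z'$ if such a chain concatenates them. For $k\in\mathsf L(a)$, $\mathcal R_{a,k}$ is the set of $\approx_{\mathrm{eq}}$-equivalence classes of $\mathsf Z_k(a)$. $\mu_{\mathrm{eq}}(a)=\sup\{k\in\mathsf L(a):|\mathcal R_{a,k}|>1\}$, $\mu_{\mathrm{eq}}(H)=\sup_{a\in H}\mu_{\mathrm{eq}}(a)$. $\mu_{\mathrm{adj}}(a)=\sup\{k\in\mathsf L(a):\text{there is }l\in\mathsf L(a),\ l<k,\ l\text{ adjacent to }k,\text{ with }\mathsf d(\mathsf Z_k(a),\mathsf Z_l(a))=k\}$, $\mu_{\mathrm{adj}}(H)=\sup_{a\in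 H}\mu_{\mathrm{adj}}(a)$. Monoids of relations: $\sim_H=\{(x,y)\in\mathsf Z(H)^2:\pi_H(x)=\pi_H(y)\}$, $\sim_{H,\mathrm{eq}}=\{(x,y)\in\sim_H:|x|=|y|\}$, $\sim_{H,\mathrm{mon}}=\{(x,y)\in\sim_H:|x|\le|y|\}$; $\mathcal A(M)$ is the set of atoms of a monoid $M$, and $\mathcal A_a(\sim_{H,\mathrm{eq}})=\mathcal A(\sim_{H,\mathrm{eq}})\cap(\mathsf Z(a)\times\mathsf Z(a))$, $\mathcal A_a(\sim_{H,\mathrm{mon}})=\mathcal A(\sim_{H,\mathrm{mon}})\cap(\mathsf Z(a)\times\mathsf Z(a))$. *)

theory Defs
  imports "HOL-Algebra.Divisibility" "HOL-Algebra.FiniteProduct"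
    "HOL-Library.Multiset" "HOL-Library.Extended_Nat"
begin

locale atomic_monoid = comm_monoid_cancel H for H (structure) +
  assumes factors_exist:
    "\<lbrakk>a \<in> carrier H; a \<notin> Units H\<rbrakk> \<Longrightarrow> \<exists>fs. set fs \<subseteq> carrier H \<and> factors H fs a"

text \<open>For cancellative commutative monoids, \<^const>\<open>irreducible\<close> says that \<open>u\<close> is a non-unit and
  \<open>u = b c\<close> forces \<open>b\<close> or \<open>c\<close> to be a unit.\<close>

definition atoms :: "('a, 'b) monoid_scheme \<Rightarrow> 'a set" where
  "atoms M = {u \<in> carrier M. irreducible M u}"

text \<open>The quotient construction of the library only needs a monoid record; its elements here are
  the cosets of the unit group.\<close>

definition red :: "('a, 'b) monoid_scheme \<Rightarrow> 'a set monoid" where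
  "red H = H Mod Units H"

text \<open>The free abelian monoid on the atoms of the reduced monoid: formal products are multisets,
  so length is \<^const>\<open>size\<close>, the gcd is multiset intersection and division is multiset
  difference.\<close>

definition fact_monoid :: "('a, 'b) monoid_scheme \<Rightarrow> 'a set multiset monoid" where
  "fact_monoid H = \<lparr>carrier = {z. set_mset z \<subseteq> atoms (red H)}, mult = (+), one = {#}\<rparr>"

definition fact_hom :: "('a, 'b) monoid_scheme \<Rightarrow> 'a set multiset \<Rightarrow> 'a set" where
  "fact_hom H z = finprod (red H) (\<lambda>u. u [^]\<^bsub>red H\<^esub> count z u) (set_mset z)"

definition facts_of :: "('a, 'b) monoid_scheme \<Rightarrow> 'a \<Rightarrow> 'a set multiset set" where
  "facts_of H a = {z \<in> carrier (fact_monoid H). fact_hom H z = Units H #>\<^bsub>H\<^esub> a}"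

definition lengths :: "('a, 'b) monoid_scheme \<Rightarrow> 'a \<Rightarrow> nat set" where
  "lengths H a = size ` facts_of H a"

definition facts_len :: "('a, 'b) monoid_scheme \<Rightarrow> 'a \<Rightarrow> nat \<Rightarrow> 'a set multiset set" where
  "facts_len H a k = {z \<in> facts_of H a. size z = k}"

definition fdist :: "'c multiset \<Rightarrow> 'c multiset \<Rightarrow> nat" where
  "fdist z z' = max (size (z - (z \<inter># z'))) (size (z' - (z \<inter># z')))"

text \<open>Only used for non-empty sets, where \<^const>\<open>Inf\<close> on the naturals is the minimum.\<close>

definition fdist_set :: "'c multiset set \<Rightarrow> 'c multiset set \<Rightarrow> nat" where
  "fdist_set X Y = Inf {fdist x y | x y. x \<in> X \<and> y \<in> Y}"

definition adjacent :: "('a, 'b) monoid_scheme \<Rightarrow> 'a \<Rightarrow> nat \<Rightarrow> nat \<Rightarrow> bool" where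
  "adjacent H a k l \<longleftrightarrow> k \<in> lengths H a \<and> l \<in> lengths H a \<and> k < l \<and>
     {k..l} \<inter> lengths H a = {k, l}"

definition mon_chain ::
    "('a, 'b) monoid_scheme \<Rightarrow> 'a \<Rightarrow> enat \<Rightarrow> 'a set multiset \<Rightarrow> 'a set multiset \<Rightarrow> bool" where
  "mon_chain H a N z z' \<longleftrightarrow> (\<exists>(n::nat) w. 1 \<le> n \<and> w 0 = z \<and> w n = z' \<and>
     (\<forall>i\<le>n. w i \<in> facts_of H a) \<and>
     (\<forall>i<n. enat (fdist (w i) (w (Suc i))) \<le> N \<and> size (w i) \<le> size (w (Suc i))))"

definition eq_chain ::
    "('a, 'b) monoid_scheme \<Rightarrow> 'a \<Rightarrow> enat \<Rightarrow> 'a set multiset \<Rightarrow> 'a set multiset \<Rightarrow> bool" where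
  "eq_chain H a N z z' \<longleftrightarrow> (\<exists>(n::nat) w. 1 \<le> n \<and> w 0 = z \<and> w n = z' \<and>
     (\<forall>i\<le>n. w i \<in> facts_of H a) \<and>
     (\<forall>i<n. enat (fdist (w i) (w (Suc i))) \<le> N \<and> size (w i) = size (w (Suc i))))"

text \<open>Suprema below are taken in \<^typ>\<open>enat\<close>, where the supremum of the empty set is \<open>0\<close>.
  A monotone chain can only join \<open>z\<close> to \<open>z'\<close> if \<open>z\<close> is not longer than \<open>z'\<close>, and an equal-length
  chain only if the lengths agree; the catenary degrees quantify over exactly such pairs.\<close>

definition c_mon_elt :: "('a, 'b) monoid_scheme \<Rightarrow> 'a \<Rightarrow> enat" where
  "c_mon_elt H a = (LEAST N. \<forall>z\<in>facts_of H a. \<forall>z'\<in>facts_of H a.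
     size z \<le> size z' \<longrightarrow> mon_chain H a N z z')"

definition c_eq_elt :: "('a, 'b) monoid_scheme \<Rightarrow> 'a \<Rightarrow> enat" where
  "c_eq_elt H a = (LEAST N. \<forall>z\<in>facts_of H a. \<forall>z'\<in>facts_of H a.
     size z = size z' \<longrightarrow> eq_chain H a N z z')"

definition c_adj_elt :: "('a, 'b) monoid_scheme \<Rightarrow> 'a \<Rightarrow> enat" where
  "c_adj_elt H a =
     Sup {enat (fdist_set (facts_len H a k) (facts_len H a l)) | k l. adjacent H a k l}"

definition c_mon :: "('a, 'b) monoid_scheme \<Rightarrow> enat" where
  "c_mon H = (SUP a\<in>carrier H. c_mon_elt H a)"

definition c_eq :: "('a, 'b) monoid_scheme \<Rightarrow> enat" where
  "c_eq H = (SUP a\<in>carrier H. c_eq_elt H a)"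

definition c_adj :: "('a, 'b) monoid_scheme \<Rightarrow> enat" where
  "c_adj H = (SUP a\<in>carrier H. c_adj_elt H a)"

definition eq_R_related ::
    "('a, 'b) monoid_scheme \<Rightarrow> 'a \<Rightarrow> 'a set multiset \<Rightarrow> 'a set multiset \<Rightarrow> bool" where
  "eq_R_related H a z z' \<longleftrightarrow> (\<exists>(n::nat) w. w 0 = z \<and> w n = z' \<and>
     (\<forall>i\<le>n. w i \<in> facts_of H a) \<and>
     (\<forall>i<n. w i \<inter># w (Suc i) \<noteq> {#} \<and> size (w i) = size (w (Suc i))))"

definition R_classes :: "('a, 'b) monoid_scheme \<Rightarrow> 'a \<Rightarrow> nat \<Rightarrow> 'a set multiset set set" where
  "R_classes H a k = facts_len H a k //
     {(z, z'). z \<in> facts_len H a k \<and> z' \<in> facts_len H a k \<and> eq_R_related H a z z'}"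

text \<open>Infinite sets have \<^const>\<open>card\<close> zero, so that case is listed separately.\<close>

definition many_R_classes :: "('a, 'b) monoid_scheme \<Rightarrow> 'a \<Rightarrow> nat \<Rightarrow> bool" where
  "many_R_classes H a k \<longleftrightarrow> infinite (R_classes H a k) \<or> card (R_classes H a k) > 1"

definition mu_eq_elt :: "('a, 'b) monoid_scheme \<Rightarrow> 'a \<Rightarrow> enat" where
  "mu_eq_elt H a = Sup {enat k | k. k \<in> lengths H a \<and> many_R_classes H a k}"

definition mu_adj_elt :: "('a, 'b) monoid_scheme \<Rightarrow> 'a \<Rightarrow> enat" where
  "mu_adj_elt H a = Sup {enat k | k. k \<in> lengths H a \<and>
     (\<exists>l. adjacent H a l k \<and> fdist_set (facts_len H a k) (facts_len H a l) = k)}"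

definition mu_eq :: "('a, 'b) monoid_scheme \<Rightarrow> enat" where
  "mu_eq H = (SUP a\<in>carrier H. mu_eq_elt H a)"

definition mu_adj :: "('a, 'b) monoid_scheme \<Rightarrow> enat" where
  "mu_adj H = (SUP a\<in>carrier H. mu_adj_elt H a)"

definition rel ::
    "('a, 'b) monoid_scheme \<Rightarrow> ('a set multiset \<times> 'a set multiset) set" where
  "rel H = {(x, y). x \<in> carrier (fact_monoid H) \<and> y \<in> carrier (fact_monoid H) \<and>
     fact_hom H x = fact_hom H y}"

definition rel_eq ::
    "('a, 'b) monoid_scheme \<Rightarrow> ('a set multiset \<times> 'a set multiset) monoid" where
  "rel_eq H = (fact_monoid H \<times>\<times> fact_monoid H)
     \<lparr>carrier := {(x, y) \<in> rel H. size x = size y}\<rparr>"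

definition rel_mon ::
    "('a, 'b) monoid_scheme \<Rightarrow> ('a set multiset \<times> 'a set multiset) monoid" where
  "rel_mon H = (fact_monoid H \<times>\<times> fact_monoid H)
     \<lparr>carrier := {(x, y) \<in> rel H. size x \<le> size y}\<rparr>"

definition rel_eq_atoms ::
    "('a, 'b) monoid_scheme \<Rightarrow> 'a \<Rightarrow> ('a set multiset \<times> 'a set multiset) set" where
  "rel_eq_atoms H a = atoms (rel_eq H) \<inter> (facts_of H a \<times> facts_of H a)"

definition rel_mon_atoms ::
    "('a, 'b) monoid_scheme \<Rightarrow> 'a \<Rightarrow> ('a set multiset \<times> 'a set multiset) set" where
  "rel_mon_atoms H a = atoms (rel_mon H) \<inter> (facts_of H a \<times> facts_of H a)"

end

theory Submission
  imports Defs
begin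

text \<open>If two factorizations share a factor \<open>g\<close>, cancelling \<open>g\<close> leaves two shorter factorizations
  of a common element at the same distance. Hence large distances come only from coprime pairs:
  an equal-length chain with steps below \<open>k\<close> through factorizations of length \<open>k\<close> is an
  \<open>\<R>\<close>-chain, and conversely \<open>\<R>\<close>-chains refine by induction on the length; for adjacent lengths
  one cancels the gcd of a pair of minimal distance. In a pair witnessing \<open>\<mu>\<^sub>e\<^sub>q\<close> or \<open>\<mu>\<^sub>a\<^sub>d\<^sub>j\<close> no
  exchange of subfactors is possible, so the pair is an atom of the monoid of relations. Finally
  \<open>c\<^sub>m\<^sub>o\<^sub>n\<close> is the maximum of \<open>c\<^sub>e\<^sub>q\<close> and \<open>c\<^sub>a\<^sub>d\<^sub>j\<close>, because a monotone chain between adjacent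
  lengths has exactly one step that changes the length.\<close>

section \<open>Distances of factorizations\<close>

text \<open>Both cofactors lose the same gcd, so the longer factorization keeps the longer cofactor.
  Used to see that a distance below the larger length forces a nontrivial gcd.\<close>

lemma fdist_add_size_inter: "fdist x y + size (x \<inter># y) = max (size x) (size y)"
proof -
  have "size (x - x \<inter># y) + size (x \<inter># y) = size x" "size (y - x \<inter># y) + size (x \<inter># y) = size y"
    by (simp_all only: size_union[symmetric] subset_mset.diff_add
        subset_mset.inf_le1 subset_mset.inf_le2)
  then show ?thesis
    unfolding fdist_def by linarith
qed

lemma fdist_commute: "fdist x y = fdist y x"
  unfolding fdist_def by (subst max.commute) (simp only: subset_mset.inf.commute)

lemma fdist_le_max: "fdist x y \<le> max (size x) (size y)"
  using fdist_add_size_inter[of x y] by linarith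

lemma fdist_self [simp]: "fdist x x = 0"
  by (simp add: fdist_def)

lemma inter_mset_add_right: "(x + g) \<inter># (y + g) = (x \<inter># y) + g"
  by (rule multiset_eqI) (simp add: min_def)

text \<open>A common factor adds the same amount to the gcd and to both lengths. This carries chains
  and minimal distances between an element and a cofactor.\<close>

lemma fdist_add_right [simp]: "fdist (x + g) (y + g) = fdist x y"
  using fdist_add_size_inter[of "x + g" "y + g"] fdist_add_size_inter[of x y]
  unfolding inter_mset_add_right size_union by linarith

lemma fdist_set_le: "x \<in> X \<Longrightarrow> y \<in> Y \<Longrightarrow> fdist_set X Y \<le> fdist x y"
  unfolding fdist_set_def by (intro cInf_lower) auto

lemma fdist_set_attained:
  assumes "X \<noteq> {}" "Y \<noteq> {}"
  obtains x y where "x \<in> X" "y \<in> Y" "fdist_set X Y = fdist x y"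
proof -
  have "{fdist x y | x y. x \<in> X \<and> y \<in> Y} \<noteq> {}"
    using assms by auto
  from Inf_nat_def1[OF this] show ?thesis
    using that unfolding fdist_set_def by auto
qed

lemma fdist_set_commute: "fdist_set X Y = fdist_set Y X"
proof -
  have "{fdist x y | x y. x \<in> X \<and> y \<in> Y} = {fdist x y | x y. x \<in> Y \<and> y \<in> X}"
    using fdist_commute by blast
  then show ?thesis
    by (simp add: fdist_set_def)
qed

section \<open>Chains of factorizations\<close>

text \<open>Turns indexed sequences into a transitive closure, which gives concatenation and
  induction along chains. With at least one step, membership of all terms amounts to membership of
  both ends of every step.\<close>

lemma sequence_in_iff_tranclp:
  "(\<exists>(n::nat) w. 1 \<le> n \<and> w 0 = x \<and> w n = y \<and> (\<forall>i\<le>n. w i \<in> F) \<and> (\<forall>i<n. Q (w i) (w (Suc i))))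
    \<longleftrightarrow> (\<lambda>u v. u \<in> F \<and> v \<in> F \<and> Q u v)\<^sup>+\<^sup>+ x y"
proof -
  have steps: "(\<forall>i\<le>n. w i \<in> F) \<longleftrightarrow> (\<forall>i<n. w i \<in> F \<and> w (Suc i) \<in> F)" if "1 \<le> n"
    for n :: nat and w
  proof
    assume *: "\<forall>i<n. w i \<in> F \<and> w (Suc i) \<in> F"
    show "\<forall>i\<le>n. w i \<in> F"
    proof (intro allI impI)
      fix i assume "i \<le> n"
      then show "w i \<in> F"
        using * that by (cases i) auto
    qed
  qed auto
  show ?thesis
    unfolding tranclp_power relpowp_fun_conv ex_simps(2)[symmetric] Suc_le_eq[symmetric] One_nat_def
    by (intro ex_cong1 conj_cong refl) (use steps in auto)
qed

lemma eq_chain_iff_tranclp: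
  "eq_chain H a N = (\<lambda>u v. u \<in> facts_of H a \<and> v \<in> facts_of H a \<and>
     enat (fdist u v) \<le> N \<and> size u = size v)\<^sup>+\<^sup>+"
  by (intro ext) (unfold eq_chain_def, rule sequence_in_iff_tranclp)

lemma mon_chain_iff_tranclp:
  "mon_chain H a N = (\<lambda>u v. u \<in> facts_of H a \<and> v \<in> facts_of H a \<and>
     enat (fdist u v) \<le> N \<and> size u \<le> size v)\<^sup>+\<^sup>+"
  by (intro ext) (unfold mon_chain_def, rule sequence_in_iff_tranclp)

lemma eq_R_related_refl: "z \<in> facts_of H a \<Longrightarrow> eq_R_related H a z z"
  unfolding eq_R_related_def by (intro exI[of _ 0] exI[of _ "\<lambda>_. z"]) auto

text \<open>A chain may have no steps, hence the reflexive closure; the assumption supplies the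
  membership that this closure alone does not give.\<close>

lemma eq_R_related_iff_rtranclp:
  assumes "z \<in> facts_of H a"
  shows "eq_R_related H a z z' \<longleftrightarrow> (\<lambda>u v. u \<in> facts_of H a \<and> v \<in> facts_of H a \<and>
     u \<inter># v \<noteq> {#} \<and> size u = size v)\<^sup>*\<^sup>* z z'" (is "_ \<longleftrightarrow> ?P\<^sup>*\<^sup>* z z'")
proof
  assume "eq_R_related H a z z'"
  then show "?P\<^sup>*\<^sup>* z z'"
    unfolding eq_R_related_def rtranclp_power relpowp_fun_conv
    by (metis (no_types, lifting) Suc_leI less_imp_le_nat)
next
  assume "?P\<^sup>*\<^sup>* z z'"
  then show "eq_R_related H a z z'"
  proof (cases "z = z'")
    case True
    with assms show ?thesis
      by (simp add: eq_R_related_refl)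
  next
    case False
    with rtranclpD[OF \<open>?P\<^sup>*\<^sup>* z z'\<close>] have "?P\<^sup>+\<^sup>+ z z'"
      by simp
    from sequence_in_iff_tranclp[THEN iffD2, OF this] show ?thesis
      unfolding eq_R_related_def by (elim exE conjE) (intro exI conjI)
  qed
qed

lemma eq_R_related_step:
  "\<lbrakk>u \<in> facts_of H a; v \<in> facts_of H a; u \<inter># v \<noteq> {#}; size u = size v\<rbrakk> \<Longrightarrow> eq_R_related H a u v"
  by (subst eq_R_related_iff_rtranclp) auto

lemma eq_R_related_trans:
  assumes "u \<in> facts_of H a" "v \<in> facts_of H a"
    and "eq_R_related H a u v" "eq_R_related H a v w"
  shows "eq_R_related H a u w"
  using assms by (simp add: eq_R_related_iff_rtranclp)

lemma eq_chain_step: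
  "\<lbrakk>u \<in> facts_of H a; v \<in> facts_of H a; enat (fdist u v) \<le> N; size u = size v\<rbrakk>
    \<Longrightarrow> eq_chain H a N u v"
  unfolding eq_chain_iff_tranclp by auto

lemma eq_chain_trans: "eq_chain H a N u v \<Longrightarrow> eq_chain H a N v w \<Longrightarrow> eq_chain H a N u w"
  unfolding eq_chain_iff_tranclp by (rule tranclp_trans)

lemma mon_chain_step:
  "\<lbrakk>u \<in> facts_of H a; v \<in> facts_of H a; enat (fdist u v) \<le> N; size u \<le> size v\<rbrakk>
    \<Longrightarrow> mon_chain H a N u v"
  unfolding mon_chain_iff_tranclp by auto

lemma mon_chain_trans: "mon_chain H a N u v \<Longrightarrow> mon_chain H a N v w \<Longrightarrow> mon_chain H a N u w"
  unfolding mon_chain_iff_tranclp by (rule tranclp_trans)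

lemma eq_chain_imp_mon_chain:
  assumes "eq_chain H a N u v" "N \<le> M"
  shows "mon_chain H a M u v"
  using assms(1) unfolding eq_chain_iff_tranclp mon_chain_iff_tranclp
proof (rule tranclp.induct)
  fix u v w
  assume "(\<lambda>u v. u \<in> facts_of H a \<and> v \<in> facts_of H a \<and>
     enat (fdist u v) \<le> M \<and> size u \<le> size v)\<^sup>+\<^sup>+ u v"
    and "v \<in> facts_of H a \<and> w \<in> facts_of H a \<and> enat (fdist v w) \<le> N \<and> size v = size w"
  then show "(\<lambda>u v. u \<in> facts_of H a \<and> v \<in> facts_of H a \<and>
     enat (fdist u v) \<le> M \<and> size u \<le> size v)\<^sup>+\<^sup>+ u w"
    by (elim tranclp.trancl_into_trancl) (use assms(2) order_trans in auto)
qed (use assms(2) order_trans in \<open>auto intro!: tranclp.r_into_trancl\<close>)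

lemma mon_chain_size_le: "mon_chain H a N u v \<Longrightarrow> size u \<le> size v"
  unfolding mon_chain_iff_tranclp by (induction rule: tranclp_induct) auto

text \<open>Lengths increase weakly along the chain, so equal end lengths squeeze all of them
  together.\<close>

lemma mon_chain_imp_eq_chain:
  assumes "mon_chain H a N u v" "size u = size v"
  shows "eq_chain H a N u v"
  using assms unfolding mon_chain_iff_tranclp
proof (induction rule: tranclp_induct)
  case (base y)
  then show ?case by (auto intro: eq_chain_step)
next
  case (step y z)
  have "size u \<le> size y"
    using step.hyps(1) by (intro mon_chain_size_le) (simp add: mon_chain_iff_tranclp)
  then have "size u = size y" "size y = size z"
    using step.hyps(2) step.prems by auto
  with step show ?case
    by (blast intro: eq_chain_trans eq_chain_step)
qed

section \<open>Catenary degrees as attained bounds\<close>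

lemma c_eq_elt_chain:
  assumes "z \<in> facts_of H a" "z' \<in> facts_of H a" "size z = size z'"
  shows "eq_chain H a (c_eq_elt H a) z z'"
proof -
  have "\<forall>z\<in>facts_of H a. \<forall>z'\<in>facts_of H a. size z = size z' \<longrightarrow> eq_chain H a (c_eq_elt H a) z z'"
    \<comment> \<open>With the bound \<open>\<infinity>\<close> a single step always suffices, so
      \<open>LEAST\<close> ranges over a nonempty set.\<close>
    unfolding c_eq_elt_def by (rule LeastI[of _ \<infinity>]) (auto intro: eq_chain_step)
  with assms show ?thesis by blast
qed

lemma c_eq_elt_leI:
  assumes "\<And>z z'. \<lbrakk>z \<in> facts_of H a; z' \<in> facts_of H a; size z = size z'\<rbrakk> \<Longrightarrow> eq_chain H a N z z'"
  shows "c_eq_elt H a \<le> N"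
  unfolding c_eq_elt_def by (rule Least_le) (use assms in blast)

lemma c_mon_elt_chain:
  assumes "z \<in> facts_of H a" "z' \<in> facts_of H a" "size z \<le> size z'"
  shows "mon_chain H a (c_mon_elt H a) z z'"
proof -
  have "\<forall>z\<in>facts_of H a. \<forall>z'\<in>facts_of H a. size z \<le> size z' \<longrightarrow> mon_chain H a (c_mon_elt H a) z z'"
    unfolding c_mon_elt_def by (rule LeastI[of _ \<infinity>]) (auto intro: mon_chain_step)
  with assms show ?thesis by blast
qed

lemma c_mon_elt_leI:
  assumes "\<And>z z'. \<lbrakk>z \<in> facts_of H a; z' \<in> facts_of H a; size z \<le> size z'\<rbrakk> \<Longrightarrow> mon_chain H a N z z'"
  shows "c_mon_elt H a \<le> N"
  unfolding c_mon_elt_def by (rule Least_le) (use assms in blast)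

section \<open>Equal-length R-classes\<close>

lemma many_R_classes_iff:
  "many_R_classes H a k \<longleftrightarrow>
    (\<exists>z\<in>facts_len H a k. \<exists>z'\<in>facts_len H a k. \<not> eq_R_related H a z z')" (is "_ \<longleftrightarrow> ?rhs")
proof -
  define A where "A = facts_len H a k"
  define r where "r = {(z, z'). z \<in> A \<and> z' \<in> A \<and> eq_R_related H a z z'}"
  have R: "R_classes H a k = A // r"
    by (simp add: R_classes_def A_def r_def)
  show ?thesis
  proof
    assume many: "many_R_classes H a k"
    show ?rhs
    proof (rule ccontr)
      assume "\<not> ?rhs"
      \<comment> \<open>If all factorizations are related, every class is the whole of
        \<open>A\<close>.\<close>
      then have "A // r \<subseteq> {A}"
        by (auto simp: quotient_def r_def A_def)
      then have "finite (A // r)" "card (A // r) \<le> card {A}"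
        by (blast intro: finite_subset card_mono)+
      with many show False
        by (simp add: many_R_classes_def R)
    qed
  next
    assume ?rhs
    then obtain z z' where z: "z \<in> A" "z' \<in> A" "\<not> eq_R_related H a z z'"
      by (auto simp: A_def)
    \<comment> \<open>\<open>z'\<close> separates the two classes: it lies in its own by reflexivity
      and outside that of \<open>z\<close>.\<close>
    have "z' \<in> r `` {z'}" "z' \<notin> r `` {z}"
      using z by (auto simp: r_def A_def facts_len_def eq_R_related_refl)
    then have "card {r `` {z}, r `` {z'}} = 2"
      by (metis card_2_iff)
    moreover have "{r `` {z}, r `` {z'}} \<subseteq> A // r"
      using z by (auto intro: quotientI)
    ultimately have "finite (A // r) \<Longrightarrow> 2 \<le> card (A // r)"
      by (metis card_mono)
    then show "many_R_classes H a k"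
      by (auto simp: many_R_classes_def R)
  qed
qed

lemma lengths_iff: "k \<in> lengths H a \<longleftrightarrow> facts_len H a k \<noteq> {}"
  by (auto simp: lengths_def facts_len_def)

text \<open>The empty factorization is the only one of length 0 and is related to itself by the
  chain without steps. This yields the condition \<open>k \<ge> 1\<close> in the supremum over
  lengths.\<close>

lemma many_R_classes_pos:
  assumes "many_R_classes H a k"
  shows "k \<ge> 1"
proof (rule ccontr)
  assume "\<not> k \<ge> 1"
  then have "facts_len H a k \<subseteq> {{#}}"
    by (auto simp: facts_len_def not_le)
  then show False
    using assms by (auto simp: many_R_classes_iff facts_len_def eq_R_related_refl)
qed

section \<open>Comparison of the invariants of a single element\<close>

lemma mu_eq_elt_le_c_eq_elt: "mu_eq_elt H a \<le> c_eq_elt H a"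
  unfolding mu_eq_elt_def
proof (rule Sup_least, clarify)
  fix k assume "many_R_classes H a k"
  then obtain z z' where z: "z \<in> facts_of H a" "size z = k" "z' \<in> facts_of H a" "size z' = k"
      "\<not> eq_R_related H a z z'"
    by (auto simp: many_R_classes_iff facts_len_def)
  show "enat k \<le> c_eq_elt H a"
  proof (rule ccontr)
    assume "\<not> enat k \<le> c_eq_elt H a"
    then have less: "c_eq_elt H a < enat k" by simp
    have "eq_chain H a (c_eq_elt H a) z z'"
      using z by (intro c_eq_elt_chain) auto
    \<comment> \<open>The length \<open>k\<close> is carried along: each step has distance below it,
      hence a nontrivial gcd, so the chain is an equal-length R-chain.\<close>
    then have "size z' = k \<and> z' \<in> facts_of H a \<and> eq_R_related H a z z'"
      unfolding eq_chain_iff_tranclp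
    proof (induction rule: tranclp_induct)
      case (base y)
      have "fdist z y < k"
        using base less le_less_trans enat_ord_simps(2) by blast
      then have "z \<inter># y \<noteq> {#}"
        using fdist_add_size_inter[of z y] base z(2) by auto
      then show ?case
        using base z(2) by (auto intro: eq_R_related_step)
    next
      case (step y w)
      have "fdist y w < k"
        using step less le_less_trans enat_ord_simps(2) by blast
      then have "y \<inter># w \<noteq> {#}"
        using fdist_add_size_inter[of y w] step by auto
      then show ?case
        using step z(1) by (auto intro: eq_R_related_step eq_R_related_trans)
    qed
    with z show False by simp
  qed
qed

text \<open>Each length counted on the left is itself a distance counted on the right, up to the
  order of the two sets.\<close>

lemma mu_adj_elt_le_c_adj_elt: "mu_adj_elt H a \<le> c_adj_elt H a"
  unfolding mu_adj_elt_def c_adj_elt_def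
proof (rule Sup_subset_mono, clarify)
  fix k l
  assume "adjacent H a l k" and dist: "fdist_set (facts_len H a k) (facts_len H a l) = k"
  moreover have "enat k = enat (fdist_set (facts_len H a l) (facts_len H a k))"
    using dist by (simp add: fdist_set_commute)
  ultimately show "\<exists>k' l'. enat k = enat (fdist_set (facts_len H a k') (facts_len H a l')) \<and>
      adjacent H a k' l'"
    by blast
qed

lemma c_eq_elt_le_c_mon_elt: "c_eq_elt H a \<le> c_mon_elt H a"
  by (rule c_eq_elt_leI) (simp add: mon_chain_imp_eq_chain c_mon_elt_chain)

text \<open>No length lies strictly between \<open>k\<close> and \<open>l\<close>, so some step
  jumps directly from one to the other, and its distance bounds the minimum.\<close>

lemma mon_chain_crosses_adjacent:
  assumes "mon_chain H a N z z'" "adjacent H a k l" "size z = k" "size z' = l"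
  shows "enat (fdist_set (facts_len H a k) (facts_len H a l)) \<le> N"
proof -
  let ?D = "enat (fdist_set (facts_len H a k) (facts_len H a l)) \<le> N"
  have gap: "m = k \<or> m = l" if "m \<in> lengths H a" "k \<le> m" "m \<le> l" for m
    using assms(2) that unfolding adjacent_def by (metis IntI atLeastAtMost_iff insertE singletonD)
  have one: "?D" if "u \<in> facts_of H a" "v \<in> facts_of H a" "enat (fdist u v) \<le> N"
      "size u = k" "size v = l" for u v
  proof -
    have "fdist_set (facts_len H a k) (facts_len H a l) \<le> fdist u v"
      using that by (intro fdist_set_le) (auto simp: facts_len_def)
    then show ?D
      using that(3) order_trans enat_ord_simps(1) by blast
  qed
  have len: "size v \<in> lengths H a" if "v \<in> facts_of H a" for v
    using that by (simp add: lengths_def)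
  \<comment> \<open>With the lower bound in the claim, the predecessor of a term of length
    \<open>l\<close> has length \<open>k\<close> or \<open>l\<close>: either this step jumps, or the
    jump came earlier.\<close>
  have "k \<le> size z' \<and> (size z' = l \<longrightarrow> ?D)"
    using assms(1) unfolding mon_chain_iff_tranclp
  proof (induction rule: tranclp_induct)
    case (base y)
    then show ?case
      using assms(3) one by auto
  next
    case (step y w)
    then have y: "y \<in> facts_of H a" "w \<in> facts_of H a" "enat (fdist y w) \<le> N" "size y \<le> size w"
        "k \<le> size y"
      by auto
    have ?D if "size w = l"
      using gap[OF len[OF y(1)]] y that step.IH one by auto
    with y show ?case by auto
  qed
  then show ?thesis
    using assms(4) by auto
qed

lemma c_adj_elt_le_c_mon_elt: "c_adj_elt H a \<le> c_mon_elt H a"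
  unfolding c_adj_elt_def
proof (rule Sup_least, clarify)
  fix k l assume adj: "adjacent H a k l"
  then obtain z z' where z: "z \<in> facts_of H a" "size z = k" "z' \<in> facts_of H a" "size z' = l"
    by (auto simp: adjacent_def lengths_def)
  have "mon_chain H a (c_mon_elt H a) z z'"
    using adj z by (intro c_mon_elt_chain) (auto simp: adjacent_def)
  from mon_chain_crosses_adjacent[OF this adj] z
  show "enat (fdist_set (facts_len H a k) (facts_len H a l)) \<le> c_mon_elt H a"
    by auto
qed

section \<open>The monotone catenary degree as a maximum\<close>

lemma adjacent_above:
  assumes "k \<in> lengths H a" "m \<in> lengths H a" "k < m"
  obtains l where "adjacent H a k l" "l \<le> m"
proof
  define l where "l = (LEAST l. l \<in> lengths H a \<and> k < l)"
  have l: "l \<in> lengths H a" "k < l"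
    using LeastI[of "\<lambda>l. l \<in> lengths H a \<and> k < l" m] assms by (auto simp: l_def)
  have least: "l \<le> j" if "j \<in> lengths H a" "k < j" for j
    using that by (auto simp: l_def intro: Least_le)
  show "l \<le> m"
    using least assms by blast
  have "{k..l} \<inter> lengths H a = {k, l}"
  proof (intro equalityI subsetI)
    fix x assume "x \<in> {k..l} \<inter> lengths H a"
    then show "x \<in> {k, l}"
      using least[of x] by (cases "k = x") auto
  qed (use assms l in auto)
  then show "adjacent H a k l"
    using assms l by (simp add: adjacent_def)
qed

text \<open>Climb through the lengths: move at constant length to a factorization nearest to the
  next length, jump there in one step, and repeat. The induction is on the remaining difference of
  lengths.\<close>

lemma c_mon_elt_le: "c_mon_elt H a \<le> max (c_eq_elt H a) (c_adj_elt H a)" (is "_ \<le> ?M")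
proof (rule c_mon_elt_leI)
  fix z z' assume "z \<in> facts_of H a" "z' \<in> facts_of H a" "size z \<le> size z'"
  then show "mon_chain H a ?M z z'"
  proof (induction "size z' - size z" arbitrary: z rule: less_induct)
    case less
    show ?case
    proof (cases "size z = size z'")
      case True
      then show ?thesis
        using less.prems by (intro eq_chain_imp_mon_chain[OF c_eq_elt_chain]) auto
    next
      case False
      then have "size z < size z'" "size z \<in> lengths H a" "size z' \<in> lengths H a"
        using less.prems by (auto simp: lengths_def)
      then obtain l where l: "adjacent H a (size z) l" "l \<le> size z'"
        using adjacent_above by metis
      have "facts_len H a (size z) \<noteq> {}" "facts_len H a l \<noteq> {}"
        using l by (auto simp: adjacent_def simp flip: lengths_iff)
      then obtain u v where uv: "u \<in> facts_len H a (size z)" "v \<in> facts_len H a l"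
          "fdist_set (facts_len H a (size z)) (facts_len H a l) = fdist u v"
        by (rule fdist_set_attained)
      then have u: "u \<in> facts_of H a" "size u = size z" and v: "v \<in> facts_of H a" "size v = l"
        by (auto simp: facts_len_def)
      have zl: "size z < l"
        using l by (simp add: adjacent_def)
      have "enat (fdist u v) \<le> c_adj_elt H a"
        unfolding c_adj_elt_def using l(1) uv(3)[symmetric] by (intro Sup_upper) auto
      then have "mon_chain H a ?M u v"
        using u v zl by (intro mon_chain_step) (auto simp: le_max_iff_disj)
      moreover have "mon_chain H a ?M z u"
        using u less.prems by (intro eq_chain_imp_mon_chain[OF c_eq_elt_chain]) auto
      moreover have "mon_chain H a ?M v z'"
        using v zl l(2) less.prems by (intro less.hyps) auto
      ultimately show ?thesis
        by (blast intro: mon_chain_trans)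
    qed
  qed
qed

lemma c_mon_eq_max: "c_mon H = max (c_eq H) (c_adj H)"
proof (rule antisym)
  show "c_mon H \<le> max (c_eq H) (c_adj H)"
    unfolding c_mon_def
  proof (rule SUP_least)
    fix a assume a: "a \<in> carrier H"
    have "c_eq_elt H a \<le> c_eq H" "c_adj_elt H a \<le> c_adj H"
      using a by (auto simp: c_eq_def c_adj_def intro: SUP_upper)
    then show "c_mon_elt H a \<le> max (c_eq H) (c_adj H)"
      using c_mon_elt_le[of H a] by (meson max.mono order_trans)
  qed
  show "max (c_eq H) (c_adj H) \<le> c_mon H"
    unfolding c_mon_def c_eq_def c_adj_def
    by (simp add: SUP_mono' c_eq_elt_le_c_mon_elt c_adj_elt_le_c_mon_elt)
qed

section \<open>The factorization homomorphism\<close>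

context comm_monoid_cancel
begin

section \<open>The quotient by the unit group\<close>

lemma Units_coset_mult:
  assumes "a \<in> carrier G" "b \<in> carrier G"
  shows "(Units G #> a) <#> (Units G #> b) = Units G #> (a \<otimes> b)"
proof (intro equalityI subsetI)
  fix x assume "x \<in> (Units G #> a) <#> (Units G #> b)"
  then obtain u v where uv: "u \<in> Units G" "v \<in> Units G" "x = (u \<otimes> a) \<otimes> (v \<otimes> b)"
    by (auto simp: set_mult_def r_coset_def)
  then have "x = (u \<otimes> v) \<otimes> (a \<otimes> b)"
    using assms by (simp add: m_ac Units_closed)
  then show "x \<in> Units G #> (a \<otimes> b)"
    using uv by (auto simp: r_coset_def)
next
  fix x assume "x \<in> Units G #> (a \<otimes> b)"
  then obtain u where u: "u \<in> Units G" "x = u \<otimes> (a \<otimes> b)"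
    by (auto simp: r_coset_def)
  then have "x = (u \<otimes> a) \<otimes> (\<one> \<otimes> b)"
    using assms by (simp add: m_ac Units_closed)
  then show "x \<in> (Units G #> a) <#> (Units G #> b)"
    using u by (auto simp: set_mult_def r_coset_def)
qed

lemma carrier_red: "carrier (red G) = (\<lambda>a. Units G #> a) ` carrier G"
  by (auto simp: red_def FactGroup_def RCOSETS_def)

lemma mult_red: "x \<otimes>\<^bsub>red G\<^esub> y = x <#> y"
  by (simp add: red_def FactGroup_def)

text \<open>The identity of the quotient is \<open>Units G\<close> itself; written as the coset of
  \<open>\<one>\<close> it falls under \<open>Units_coset_mult\<close>.\<close>

lemma one_red: "\<one>\<^bsub>red G\<^esub> = Units G #> \<one>"
proof -
  have "Units G #> \<one> = Units G"
    by (auto simp: r_coset_def Units_closed)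
  then show ?thesis
    by (simp add: red_def FactGroup_def)
qed

text \<open>Equality of the cosets provides a unit multiple, and cancelling \<open>c\<close> in
  \<open>G\<close> leaves the same unit.\<close>

lemma Units_coset_cancel:
  assumes "a \<in> carrier G" "b \<in> carrier G" "c \<in> carrier G"
    and "Units G #> (a \<otimes> c) = Units G #> (b \<otimes> c)"
  shows "Units G #> a = Units G #> b"
proof -
  have le: "Units G #> x \<subseteq> Units G #> y"
    if x: "x \<in> carrier G" and y: "y \<in> carrier G" and eq: "Units G #> (x \<otimes> c) = Units G #> (y \<otimes> c)" for x y
  proof
    fix t assume "t \<in> Units G #> x"
    then obtain u where u: "u \<in> Units G" "t = u \<otimes> x"
      by (auto simp: r_coset_def)
    then have "t \<otimes> c \<in> Units G #> (x \<otimes> c)"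
      using x assms(3) by (auto simp: r_coset_def m_assoc Units_closed)
    then obtain v where v: "v \<in> Units G" "t \<otimes> c = v \<otimes> (y \<otimes> c)"
      using eq by (auto simp: r_coset_def)
    then have "t \<otimes> c = (v \<otimes> y) \<otimes> c"
      using y assms(3) by (simp add: m_assoc Units_closed)
    then have "t = v \<otimes> y"
      by (rule r_cancel) (use u v x y assms(3) in \<open>auto simp: Units_closed\<close>)
    then show "t \<in> Units G #> y"
      using v by (auto simp: r_coset_def)
  qed
  from le[of a b] le[of b a] assms show ?thesis
    by auto
qed

lemma comm_monoid_cancel_red: "comm_monoid_cancel (red G)"
proof -
  have "comm_monoid (red G)"
  proof (rule comm_monoidI)
    fix x y z
    assume "x \<in> carrier (red G)" "y \<in> carrier (red G)" "z \<in> carrier (red G)"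
    then obtain a b c where abc: "a \<in> carrier G" "b \<in> carrier G" "c \<in> carrier G"
        "x = Units G #> a" "y = Units G #> b" "z = Units G #> c"
      unfolding carrier_red by blast
    show "(x \<otimes>\<^bsub>red G\<^esub> y) \<otimes>\<^bsub>red G\<^esub> z = x \<otimes>\<^bsub>red G\<^esub> (y \<otimes>\<^bsub>red G\<^esub> z)"
      using abc by (simp add: mult_red Units_coset_mult m_assoc)
  next
    fix x y
    assume "x \<in> carrier (red G)" "y \<in> carrier (red G)"
    then obtain a b where ab: "a \<in> carrier G" "b \<in> carrier G"
        "x = Units G #> a" "y = Units G #> b"
      unfolding carrier_red by blast
    show "x \<otimes>\<^bsub>red G\<^esub> y \<in> carrier (red G)"
      using ab by (simp add: carrier_red mult_red Units_coset_mult)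
    show "x \<otimes>\<^bsub>red G\<^esub> y = y \<otimes>\<^bsub>red G\<^esub> x"
      using ab by (simp add: mult_red Units_coset_mult m_comm)
  next
    fix x
    assume "x \<in> carrier (red G)"
    then obtain a where "a \<in> carrier G" "x = Units G #> a"
      unfolding carrier_red by blast
    then show "\<one>\<^bsub>red G\<^esub> \<otimes>\<^bsub>red G\<^esub> x = x"
      by (simp add: mult_red one_red Units_coset_mult)
  qed (simp add: carrier_red one_red)
  then show ?thesis
  proof (rule comm_monoid_cancelI)
    fix x y z
    assume "x \<otimes>\<^bsub>red G\<^esub> z = y \<otimes>\<^bsub>red G\<^esub> z"
      and "x \<in> carrier (red G)" "y \<in> carrier (red G)" "z \<in> carrier (red G)"
    moreover from this(2-) obtain a b c where abc: "a \<in> carrier G" "b \<in> carrier G" "c \<in> carrier G"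
        "x = Units G #> a" "y = Units G #> b" "z = Units G #> c"
      unfolding carrier_red by blast
    ultimately show "x = y"
      using Units_coset_cancel[of a b c] by (simp add: mult_red Units_coset_mult)
  qed
qed

lemma atoms_red_subset: "atoms (red G) \<subseteq> carrier (red G)"
  by (auto simp: atoms_def)

lemma fact_monoid_carrier_iff: "z \<in> carrier (fact_monoid G) \<longleftrightarrow> set_mset z \<subseteq> atoms (red G)"
  by (simp add: fact_monoid_def)

lemma fact_hom_closed:
  assumes "z \<in> carrier (fact_monoid G)"
  shows "fact_hom G z \<in> carrier (red G)"
proof -
  interpret R: comm_monoid_cancel "red G" by (rule comm_monoid_cancel_red)
  show ?thesis
    unfolding fact_hom_def
    using assms atoms_red_subset by (intro R.finprod_closed) (auto simp: fact_monoid_carrier_iff)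
qed

lemma fact_hom_add:
  assumes "x \<in> carrier (fact_monoid G)" "y \<in> carrier (fact_monoid G)"
  shows "fact_hom G (x + y) = fact_hom G x \<otimes>\<^bsub>red G\<^esub> fact_hom G y"
proof -
  interpret R: comm_monoid_cancel "red G" by (rule comm_monoid_cancel_red)
  \<comment> \<open>The three products have different supports. Over the common set \<open>A\<close>
    the additional factors are powers with exponent 0, so the products can be multiplied
    termwise.\<close>
  define A where "A = set_mset (x + y)"
  have A: "finite A" "A \<subseteq> carrier (red G)"
    using assms atoms_red_subset by (auto simp: A_def fact_monoid_carrier_iff)
  have ext: "fact_hom G z = finprod (red G) (\<lambda>u. u [^]\<^bsub>red G\<^esub> count z u) A"
    if "set_mset z \<subseteq> A" for z
    unfolding fact_hom_def
    using A that by (intro R.finprod_mono_neutral_cong_left) (auto simp: not_in_iff)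
  have "fact_hom G (x + y) =
      finprod (red G) (\<lambda>u. u [^]\<^bsub>red G\<^esub> count x u \<otimes>\<^bsub>red G\<^esub> u [^]\<^bsub>red G\<^esub> count y u) A"
    unfolding ext[OF eq_refl[OF A_def[symmetric]]]
    using A by (intro R.finprod_cong') (auto simp: R.nat_pow_mult)
  also have "\<dots> = fact_hom G x \<otimes>\<^bsub>red G\<^esub> fact_hom G y"
    using A by (subst R.finprod_multf) (auto simp: ext A_def)
  finally show ?thesis .
qed

section \<open>Exchange and cancellation of subfactors\<close>

lemma facts_of_relD:
  assumes "x \<in> facts_of G a" "y \<in> facts_of G a"
  shows "(x, y) \<in> rel G"
  using assms by (auto simp: facts_of_def rel_def)

text \<open>As \<open>fact_hom\<close> is multiplicative, a subfactor may be exchanged for any other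
  of the same value.\<close>

lemma facts_of_add_swap:
  assumes "x + g \<in> facts_of G a" "(x, y) \<in> rel G"
  shows "y + g \<in> facts_of G a"
proof -
  have "g \<in> carrier (fact_monoid G)" "y + g \<in> carrier (fact_monoid G)"
    using assms by (auto simp: facts_of_def rel_def fact_monoid_carrier_iff)
  then show ?thesis
    using assms by (auto simp: facts_of_def rel_def fact_hom_add)
qed

text \<open>Take for \<open>b\<close> a representative of the value of \<open>x\<close>;
  cancellation in \<open>red G\<close> does the rest. This is the tool for reducing to pairs without
  a common factor.\<close>

lemma facts_of_cofactor:
  assumes "x + g \<in> facts_of G a"
  obtains b where "b \<in> carrier G" "\<And>y. y + g \<in> facts_of G a \<longleftrightarrow> y \<in> facts_of G b"
proof -
  interpret R: comm_monoid_cancel "red G" by (rule comm_monoid_cancel_red)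
  have c: "x \<in> carrier (fact_monoid G)" "g \<in> carrier (fact_monoid G)"
    using assms by (auto simp: facts_of_def fact_monoid_carrier_iff)
  then obtain b where b: "b \<in> carrier G" "fact_hom G x = Units G #> b"
    using fact_hom_closed[of x] by (auto simp: carrier_red)
  have "y + g \<in> facts_of G a \<longleftrightarrow> y \<in> facts_of G b" for y
  proof
    assume "y \<in> facts_of G b"
    then show "y + g \<in> facts_of G a"
      using c b by (intro facts_of_add_swap[OF assms]) (auto simp: facts_of_def rel_def)
  next
    assume y: "y + g \<in> facts_of G a"
    then have yc: "y \<in> carrier (fact_monoid G)"
      by (auto simp: facts_of_def fact_monoid_carrier_iff)
    have "fact_hom G y \<otimes>\<^bsub>red G\<^esub> fact_hom G g = fact_hom G x \<otimes>\<^bsub>red G\<^esub> fact_hom G g"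
      using y assms c yc by (simp add: facts_of_def flip: fact_hom_add)
    then have "fact_hom G y = fact_hom G x"
      by (rule R.r_cancel) (use c yc fact_hom_closed in auto)
    then show "y \<in> facts_of G b"
      using yc b by (simp add: facts_of_def)
  qed
  with b that show ?thesis by blast
qed

section \<open>Equal catenary degrees\<close>

lemma eq_chain_add_right:
  assumes "eq_chain G b N x y" "\<And>y. y \<in> facts_of G b \<Longrightarrow> y + g \<in> facts_of G a"
  shows "eq_chain G a N (x + g) (y + g)"
  using assms(1) unfolding eq_chain_iff_tranclp
proof (induction rule: tranclp_induct)
  case (base y)
  then show ?case
    using assms(2) by (intro tranclp.r_into_trancl) auto
next
  case (step y z)
  then show ?case
    using assms(2) by (intro tranclp.trancl_into_trancl[OF step.IH]) auto
qed

text \<open>Above length \<open>N\<close> there is only one class, and two consecutive members of an equal-length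
  \<open>\<R>\<close>-chain differ only in strictly shorter cofactors, to which the induction applies.\<close>

lemma eq_chain_of_bounded_classes:
  assumes "\<And>a k. \<lbrakk>a \<in> carrier G; k \<in> lengths G a; many_R_classes G a k\<rbrakk> \<Longrightarrow> enat k \<le> N"
    and "a \<in> carrier G" "z \<in> facts_of G a" "z' \<in> facts_of G a" "size z = size z'"
  shows "eq_chain G a N z z'"
  using assms(2-)
\<comment> \<open>\<open>a\<close> varies because the cofactors are factorizations of a different
  element.\<close>
proof (induction "size z" arbitrary: a z z' rule: less_induct)
  case less
  show ?case
  proof (cases "enat (size z) \<le> N")
    case True
    moreover have "enat (fdist z z') \<le> enat (size z)"
      using fdist_le_max[of z z'] less.prems(4) by simp
    ultimately have "enat (fdist z z') \<le> N"
      by (rule order_trans[rotated])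
    then show ?thesis
      using less.prems by (intro eq_chain_step)
  next
    case False
    have "\<not> many_R_classes G a (size z)"
      using False assms(1)[of a "size z"] less.prems by (auto simp: lengths_def)
    then have "eq_R_related G a z z'"
      using less.prems by (auto simp: many_R_classes_iff facts_len_def)
    then have "(\<lambda>u v. u \<in> facts_of G a \<and> v \<in> facts_of G a \<and>
        u \<inter># v \<noteq> {#} \<and> size u = size v)\<^sup>*\<^sup>* z z'"
      using less.prems by (simp add: eq_R_related_iff_rtranclp)
    \<comment> \<open>Constancy of length is carried along to make the cofactors shorter than
      \<open>z\<close>.\<close>
    then have "size z' = size z \<and> eq_chain G a N z z'"
    proof (induction rule: rtranclp_induct)
      case base
      show ?case
        using less.prems by (auto intro: eq_chain_step simp: zero_enat_def[symmetric])
    next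
      case (step u v)
      define g where "g = u \<inter># v"
      define x where "x = u - g"
      define y where "y = v - g"
      have uv: "u = x + g" "v = y + g"
        by (simp_all only: x_def y_def g_def subset_mset.diff_add subset_mset.inf_le1
            subset_mset.inf_le2)
      have g: "g \<noteq> {#}"
        using step.hyps by (simp add: g_def)
      from step.hyps have "x + g \<in> facts_of G a"
        by (simp flip: uv)
      then obtain b where b: "b \<in> carrier G" "\<And>y. y + g \<in> facts_of G a \<longleftrightarrow> y \<in> facts_of G b"
        using facts_of_cofactor by blast
      have "size x < size z"
        using step g by (simp add: uv nonempty_has_size)
      moreover have "x \<in> facts_of G b" "y \<in> facts_of G b" "size x = size y"
        using step.hyps uv b(2) by auto
      ultimately have "eq_chain G b N x y"
        using less.hyps b(1) by blast
      then have "eq_chain G a N u v"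
        using eq_chain_add_right b(2) uv by blast
      then show ?case
        using step by (auto intro: eq_chain_trans)
    qed
    then show ?thesis by simp
  qed
qed

lemma le_mu_eq:
  assumes "a \<in> carrier G" "k \<in> lengths G a" "many_R_classes G a k"
  shows "enat k \<le> mu_eq G"
proof -
  have "enat k \<le> mu_eq_elt G a"
    unfolding mu_eq_elt_def using assms by (intro Sup_upper) auto
  also have "\<dots> \<le> mu_eq G"
    unfolding mu_eq_def using assms(1) by (rule SUP_upper)
  finally show ?thesis .
qed

lemma c_eq_eq_mu_eq: "c_eq G = mu_eq G"
proof (rule antisym)
  show "c_eq G \<le> mu_eq G"
    unfolding c_eq_def
    by (intro SUP_least c_eq_elt_leI eq_chain_of_bounded_classes) (rule le_mu_eq)
  show "mu_eq G \<le> c_eq G"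
    unfolding c_eq_def mu_eq_def by (rule SUP_mono') (rule mu_eq_elt_le_c_eq_elt)
qed

section \<open>Atoms of the monoids of relations\<close>

text \<open>One criterion serves both monoids of relations, which differ only in their carriers. A
  proper divisor leaves a nontrivial cofactor, so by \<open>split\<close> it must be the empty pair,
  the only unit.\<close>

lemma atom_of_submonoid_pairs:
  fixes C :: "('a set multiset \<times> 'a set multiset) set"
  defines "M \<equiv> (fact_monoid G \<times>\<times> fact_monoid G)\<lparr>carrier := C\<rparr>"
  assumes one: "({#}, {#}) \<in> C" and xy: "(x, y) \<in> C" and ne: "(x, y) \<noteq> ({#}, {#})"
    and split: "\<And>x1 y1 x2 y2. \<lbrakk>(x1, y1) \<in> C; (x2, y2) \<in> C; x = x1 + x2; y = y1 + y2;
      (x1, y1) \<noteq> ({#}, {#}); (x2, y2) \<noteq> ({#}, {#})\<rbrakk> \<Longrightarrow> False"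
  shows "(x, y) \<in> atoms M"
proof -
  have M: "carrier M = C" "\<one>\<^bsub>M\<^esub> = ({#}, {#})"
      "\<And>p q. p \<otimes>\<^bsub>M\<^esub> q = (fst p + fst q, snd p + snd q)"
    by (auto simp: M_def DirProd_def fact_monoid_def case_prod_beta)
  \<comment> \<open>A sum of multisets is empty only if both summands are.\<close>
  have Units: "Units M = {({#}, {#})}"
    using one by (auto simp: Units_def M intro!: bexI[OF _ one])
  have "irreducible M (x, y)"
  proof (rule irreducibleI)
    show "(x, y) \<notin> Units M"
      using ne by (simp add: Units)
    fix p assume p: "p \<in> carrier M" "properfactor M p (x, y)"
    then obtain q where q: "q \<in> C" "(x, y) = (fst p + fst q, snd p + snd q)"
      by (auto simp: properfactor_def factor_def M)
    have "q \<noteq> ({#}, {#})"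
    proof
      assume "q = ({#}, {#})"
      then have "(x, y) = p"
        using q by simp
      then have "(x, y) divides\<^bsub>M\<^esub> p"
        using one by (auto simp: factor_def M intro!: bexI[OF _ one])
      then show False
        using p by (simp add: properfactor_def)
    qed
    then show "p \<in> Units M"
      using split[of "fst p" "snd p" "fst q" "snd q"] p q by (auto simp: M Units)
  qed
  then show ?thesis
    using xy by (simp add: atoms_def M)
qed

lemma empty_rel: "({#}, {#}) \<in> rel G"
  by (simp add: rel_def fact_monoid_def)

text \<open>If \<open>(z, z')\<close> splits as \<open>(x\<^sub>1, y\<^sub>1)(x\<^sub>2, y\<^sub>2)\<close>, then \<open>x\<^sub>1x\<^sub>2, x\<^sub>2y\<^sub>1, y\<^sub>1y\<^sub>2\<close> is an equal-length
  \<open>\<R>\<close>-chain.\<close>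

lemma rel_eq_atom_of_unrelated:
  assumes z: "z \<in> facts_of G a" "z' \<in> facts_of G a" "size z = size z'"
    and unrelated: "\<not> eq_R_related G a z z'"
  shows "(z, z') \<in> rel_eq_atoms G a"
proof -
  have "(z, z') \<in> atoms (rel_eq G)"
    unfolding rel_eq_def
  proof (rule atom_of_submonoid_pairs)
    show "({#}, {#}) \<in> {(x, y) \<in> rel G. size x = size y}"
      using empty_rel by simp
    show "(z, z') \<in> {(x, y) \<in> rel G. size x = size y}"
      using z facts_of_relD by simp
    show "(z, z') \<noteq> ({#}, {#})"
      using z(1) unrelated eq_R_related_refl[of z G a] by auto
    fix x1 y1 x2 y2
    assume 1: "(x1, y1) \<in> {(x, y) \<in> rel G. size x = size y}"
      and 2: "(x2, y2) \<in> {(x, y) \<in> rel G. size x = size y}"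
      and eq: "z = x1 + x2" "z' = y1 + y2"
      and ne: "(x1, y1) \<noteq> ({#}, {#})" "(x2, y2) \<noteq> ({#}, {#})"
    have m: "y1 + x2 \<in> facts_of G a"
      using facts_of_add_swap[of x1 x2 a y1] z(1) 1 eq by auto
    have size: "size z = size (y1 + x2)" "size (y1 + x2) = size z'"
      using 1 2 eq by auto
    \<comment> \<open>Paired components have equal length, so an empty one would make its whole pair
      trivial.\<close>
    have "x2 \<noteq> {#}" "y1 \<noteq> {#}"
      using ne 1 2 by auto
    then have "(x1 + x2) \<inter># (y1 + x2) \<noteq> {#}" "(y1 + x2) \<inter># (y1 + y2) \<noteq> {#}"
      using inter_mset_add_right[of x1 x2 y1] inter_mset_add_right[of x2 y1 y2]
      by (simp_all add: add.commute)
    then have "eq_R_related G a z (y1 + x2)" "eq_R_related G a (y1 + x2) z'"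
      unfolding eq[symmetric] using z m size by (blast intro: eq_R_related_step)+
    from eq_R_related_trans[OF z(1) m this] show False
      using unrelated by contradiction
  qed
  with z show ?thesis
    by (simp add: rel_eq_atoms_def)
qed

lemma rel_eq_atoms_nonempty: "many_R_classes G a k \<Longrightarrow> rel_eq_atoms G a \<noteq> {}"
  using rel_eq_atom_of_unrelated by (force simp: many_R_classes_iff facts_len_def)

text \<open>The added conditions discard no index: a length with several classes is positive, and
  its element carries an atom.\<close>

lemma c_eq_eq_Sup_lengths:
  "c_eq G = Sup {enat k | k a. k \<ge> 1 \<and> a \<in> carrier G \<and> rel_eq_atoms G a \<noteq> {} \<and>
     k \<in> lengths G a \<and> many_R_classes G a k}" (is "_ = Sup ?S")
proof (rule antisym)
  show "c_eq G \<le> Sup ?S"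
    unfolding c_eq_eq_mu_eq mu_eq_def mu_eq_elt_def
  proof (intro SUP_least Sup_subset_mono, clarify)
    fix a k assume "a \<in> carrier G" "k \<in> lengths G a" and many: "many_R_classes G a k"
    then show "\<exists>k' a. enat k = enat k' \<and> k' \<ge> 1 \<and> a \<in> carrier G \<and>
        rel_eq_atoms G a \<noteq> {} \<and> k' \<in> lengths G a \<and> many_R_classes G a k'"
      using many_R_classes_pos[OF many] rel_eq_atoms_nonempty[OF many] by blast
  qed
  show "Sup ?S \<le> c_eq G"
    unfolding c_eq_eq_mu_eq by (intro Sup_least) (auto intro: le_mu_eq)
qed

text \<open>The supremum lies between the one over single lengths and \<open>mu_eq G\<close>, both
  equal to \<open>c_eq G\<close>.\<close>

lemma c_eq_eq_Sup_mu_eq_elt: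
  "c_eq G = Sup {mu_eq_elt G a | a. a \<in> carrier G \<and> rel_eq_atoms G a \<noteq> {} \<and>
     (\<exists>k\<in>lengths G a. many_R_classes G a k)}" (is "_ = Sup ?S")
proof (rule antisym)
  show "c_eq G \<le> Sup ?S"
    unfolding c_eq_eq_Sup_lengths
  proof (rule Sup_least, clarify)
    fix k a
    assume *: "a \<in> carrier G" "rel_eq_atoms G a \<noteq> {}" "k \<in> lengths G a" "many_R_classes G a k"
    then have "enat k \<le> mu_eq_elt G a"
      unfolding mu_eq_elt_def by (intro Sup_upper) auto
    also have "\<dots> \<le> Sup ?S"
      using * by (intro Sup_upper) auto
    finally show "enat k \<le> Sup ?S" .
  qed
  show "Sup ?S \<le> c_eq G"
    unfolding c_eq_eq_mu_eq mu_eq_def by (intro Sup_least) (auto intro: SUP_upper)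
qed

section \<open>Adjacent catenary degrees\<close>

text \<open>Cancelling the gcd of a pair of factorizations at minimal distance preserves both adjacency
  of their lengths and minimality, and turns the distance into the larger length.\<close>

lemma fdist_set_adjacent_le_mu_adj:
  assumes adj: "adjacent G a k l"
  shows "enat (fdist_set (facts_len G a k) (facts_len G a l)) \<le> mu_adj G"
proof -
  have kl: "k < l" and gap: "{k..l} \<inter> lengths G a = {k, l}"
    using adj by (auto simp: adjacent_def)
  have "facts_len G a k \<noteq> {}" "facts_len G a l \<noteq> {}"
    using adj by (auto simp: adjacent_def simp flip: lengths_iff)
  then obtain z z' where zz': "z \<in> facts_len G a k" "z' \<in> facts_len G a l"
      "fdist_set (facts_len G a k) (facts_len G a l) = fdist z z'"
    by (rule fdist_set_attained)
  define g where "g = z \<inter># z'"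
  define x where "x = z - g"
  define y where "y = z' - g"
  have eq: "z = x + g" "z' = y + g"
    by (simp_all only: x_def y_def g_def subset_mset.diff_add subset_mset.inf_le1
        subset_mset.inf_le2)
  have z: "x + g \<in> facts_of G a" "size (x + g) = k" "y + g \<in> facts_of G a" "size (y + g) = l"
    using zz' by (auto simp: facts_len_def simp flip: eq)
  obtain b where b: "b \<in> carrier G" "\<And>w. w + g \<in> facts_of G a \<longleftrightarrow> w \<in> facts_of G b"
    using facts_of_cofactor[OF z(1)] by blast
  have xy: "x \<in> facts_of G b" "y \<in> facts_of G b" "size x < size y"
    using z b(2) kl by auto
  \<comment> \<open>\<open>x\<close> and \<open>y\<close> are the cofactors in the definition of the
    distance, and \<open>y\<close> is the longer one.\<close>
  have d: "fdist z z' = size y"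
    using xy(3) by (simp add: fdist_def x_def y_def g_def max_def)
  \<comment> \<open>Adding \<open>size g\<close> maps lengths of \<open>b\<close> to lengths of
    \<open>a\<close>, so a length strictly between would contradict \<open>gap\<close>.\<close>
  have "{size x..size y} \<inter> lengths G b \<subseteq> {size x, size y}"
  proof
    fix m assume m: "m \<in> {size x..size y} \<inter> lengths G b"
    then obtain w where w: "w \<in> facts_of G b" "size w = m"
      by (auto simp: lengths_def)
    then have "w + g \<in> facts_of G a"
      using b(2) by blast
    then have "size (w + g) \<in> lengths G a"
      by (simp only: lengths_def imageI)
    then have "size (w + g) \<in> {k, l}"
      unfolding gap[symmetric] using m w z by auto
    then show "m \<in> {size x, size y}"
      using w z by auto
  qed
  moreover have len: "size x \<in> lengths G b" "size y \<in> lengths G b"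
    using xy by (auto simp: lengths_def)
  ultimately have adj': "adjacent G b (size x) (size y)"
    using xy(3) by (auto simp: adjacent_def)
  have ne: "facts_len G b (size y) \<noteq> {}" "facts_len G b (size x) \<noteq> {}"
    using len by (auto simp: lengths_iff)
  have "fdist_set (facts_len G b (size y)) (facts_len G b (size x)) = size y"
  proof (rule antisym)
    have "fdist_set (facts_len G b (size y)) (facts_len G b (size x)) \<le> fdist y x"
      using xy by (intro fdist_set_le) (auto simp: facts_len_def)
    then show "fdist_set (facts_len G b (size y)) (facts_len G b (size x)) \<le> size y"
      using d eq by (simp add: fdist_commute)
    obtain v u where vu: "v \<in> facts_len G b (size y)" "u \<in> facts_len G b (size x)"
        "fdist_set (facts_len G b (size y)) (facts_len G b (size x)) = fdist v u"
      using ne by (rule fdist_set_attained)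
    have "u + g \<in> facts_len G a k" "v + g \<in> facts_len G a l"
      using vu b(2) z by (auto simp: facts_len_def)
    \<comment> \<open>A closer pair for \<open>b\<close>, multiplied by \<open>g\<close>, would be a
      closer pair for \<open>a\<close>.\<close>
    then have "fdist z z' \<le> fdist (u + g) (v + g)"
      unfolding zz'(3)[symmetric] by (rule fdist_set_le)
    then show "size y \<le> fdist_set (facts_len G b (size y)) (facts_len G b (size x))"
      using fdist_commute[of u v] by (simp add: d vu(3))
  qed
  then have "enat (size y) \<le> mu_adj_elt G b"
    unfolding mu_adj_elt_def using adj' len by (intro Sup_upper) auto
  also have "\<dots> \<le> mu_adj G"
    unfolding mu_adj_def using b(1) by (rule SUP_upper)
  finally show ?thesis
    using zz'(3) d by simp
qed

lemma c_adj_eq_mu_adj: "c_adj G = mu_adj G"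
proof (rule antisym)
  show "c_adj G \<le> mu_adj G"
    unfolding c_adj_def c_adj_elt_def
    by (intro SUP_least Sup_least) (auto intro: fdist_set_adjacent_le_mu_adj)
  show "mu_adj G \<le> c_adj G"
    unfolding c_adj_def mu_adj_def by (rule SUP_mono') (rule mu_adj_elt_le_c_adj_elt)
qed

text \<open>Maximal distance makes all factorizations of the two lengths coprime. If a pair splits as
  \<open>(x\<^sub>1, y\<^sub>1)(x\<^sub>2, y\<^sub>2)\<close>, then by adjacency \<open>x\<^sub>1y\<^sub>2\<close> has one of the two lengths, and it shares
  \<open>x\<^sub>1\<close> and \<open>y\<^sub>2\<close> with the members of the pair.\<close>

lemma rel_mon_atoms_nonempty:
  assumes adj: "adjacent G a l k"
    and dist: "fdist_set (facts_len G a k) (facts_len G a l) = k"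
  shows "rel_mon_atoms G a \<noteq> {}"
proof -
  have lk: "l < k" and gap: "{l..k} \<inter> lengths G a = {l, k}"
    using adj by (auto simp: adjacent_def)
  obtain x y where x: "x \<in> facts_of G a" "size x = l" and y: "y \<in> facts_of G a" "size y = k"
    using adj by (auto simp: adjacent_def lengths_def)
  have coprime: "u \<inter># v = {#}" if "u \<in> facts_of G a" "size u = l" "v \<in> facts_of G a" "size v = k"
    for u v
  proof -
    have "k \<le> fdist v u"
      using that by (subst dist[symmetric], intro fdist_set_le) (auto simp: facts_len_def)
    then have "size (u \<inter># v) = 0"
      using fdist_add_size_inter[of u v] that lk fdist_commute[of u v] by linarith
    then show ?thesis
      by simp
  qed
  have "(x, y) \<in> atoms (rel_mon G)"
    unfolding rel_mon_def
  proof (rule atom_of_submonoid_pairs)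
    show "({#}, {#}) \<in> {(x, y) \<in> rel G. size x \<le> size y}"
      using empty_rel by simp
    show "(x, y) \<in> {(x, y) \<in> rel G. size x \<le> size y}"
      using x y lk facts_of_relD by simp
    show "(x, y) \<noteq> ({#}, {#})"
      using y lk by auto
    fix x1 y1 x2 y2
    assume 1: "(x1, y1) \<in> {(x, y) \<in> rel G. size x \<le> size y}"
      and 2: "(x2, y2) \<in> {(x, y) \<in> rel G. size x \<le> size y}"
      and eq: "x = x1 + x2" "y = y1 + y2"
      and ne: "(x1, y1) \<noteq> ({#}, {#})" "(x2, y2) \<noteq> ({#}, {#})"
    have m: "x1 + y2 \<in> facts_of G a"
      using facts_of_add_swap[of x2 x1 a y2] x(1) 2 eq by (simp add: add.commute)
    then have "size (x1 + y2) \<in> lengths G a"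
      by (simp only: lengths_def imageI)
    \<comment> \<open>\<open>l = |x1| + |x2| \<le> |x1| + |y2| \<le> |y1| + |y2| = k\<close>, and
      adjacency leaves only the ends.\<close>
    then have "size (x1 + y2) \<in> {l, k}"
      unfolding gap[symmetric] using 1 2 eq x(2) y(2) by auto
    then consider "size (x1 + y2) = l" | "size (x1 + y2) = k"
      by blast
    then show False
    proof cases
      case 1
      \<comment> \<open>\<open>x2\<close> is no longer than \<open>y2\<close>, so an empty
        \<open>y2\<close> would make the second pair trivial.\<close>
      have "y2 \<noteq> {#}"
        using ne(2) 2 by auto
      then have "(x1 + y2) \<inter># (y1 + y2) \<noteq> {#}"
        by (simp add: inter_mset_add_right)
      then show False
        using coprime[OF m 1] y eq by simp
    next
      case 2
      \<comment> \<open>The first pair now has equal lengths, so an empty \<open>x1\<close> would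
        make it trivial.\<close>
      then have "size x1 = size y1"
        using y eq by simp
      then have "x1 \<noteq> {#}"
        using ne(1) by auto
      then have "(x1 + x2) \<inter># (x1 + y2) \<noteq> {#}"
        using inter_mset_add_right[of x2 x1 y2] by (simp add: add.commute)
      then show False
        using coprime[OF _ _ m 2] x eq by simp
    qed
  qed
  then show ?thesis
    using x y by (auto simp: rel_mon_atoms_def)
qed

text \<open>An element without such atoms has no witnessing pair of lengths, so its
  \<open>mu_adj_elt\<close> is the supremum of the empty set, namely 0, and may be left out.\<close>

lemma c_adj_eq_Sup_mu_adj_elt:
  "c_adj G = Sup {mu_adj_elt G a | a. a \<in> carrier G \<and> rel_mon_atoms G a \<noteq> {}}" (is "_ = Sup ?S")
proof (rule antisym)
  show "c_adj G \<le> Sup ?S"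
    unfolding c_adj_eq_mu_adj mu_adj_def
  proof (rule SUP_least)
    fix a assume a: "a \<in> carrier G"
    show "mu_adj_elt G a \<le> Sup ?S"
    proof (cases "rel_mon_atoms G a = {}")
      case True
      then have "mu_adj_elt G a = Sup {}"
        unfolding mu_adj_elt_def using rel_mon_atoms_nonempty by (intro arg_cong[of _ _ Sup]) auto
      then show ?thesis by simp
    next
      case False
      with a show ?thesis by (intro Sup_upper) auto
    qed
  qed
  show "Sup ?S \<le> c_adj G"
    unfolding c_adj_eq_mu_adj mu_adj_def by (intro Sup_least) (auto intro: SUP_upper)
qed

end

theorem theorem3p2:
  fixes H :: "('a, 'b) monoid_scheme"
  assumes "atomic_monoid H"
  shows
    "((\<forall>a\<in>carrier H. c_eq_elt H a \<ge> mu_eq_elt H a) \<and> c_eq H = mu_eq H) \<and>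
     (c_eq H = Sup {mu_eq_elt H a | a. a \<in> carrier H \<and> rel_eq_atoms H a \<noteq> {} \<and>
                      (\<exists>k\<in>lengths H a. many_R_classes H a k)} \<and>
      c_eq H = Sup {enat k | k a. k \<ge> 1 \<and> a \<in> carrier H \<and> rel_eq_atoms H a \<noteq> {} \<and>
                      k \<in> lengths H a \<and> many_R_classes H a k}) \<and>
     ((\<forall>a\<in>carrier H. c_adj_elt H a \<ge> mu_adj_elt H a) \<and> c_adj H = mu_adj H) \<and>
     c_adj H = Sup {mu_adj_elt H a | a. a \<in> carrier H \<and> rel_mon_atoms H a \<noteq> {}} \<and>
     c_mon H = Sup ({mu_eq_elt H a | a. a \<in> carrier H \<and> rel_eq_atoms H a \<noteq> {} \<and>
                      (\<exists>k\<in>lengths H a. many_R_classes H a k)} \<union>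
                    {mu_adj_elt H a | a. a \<in> carrier H \<and> rel_mon_atoms H a \<noteq> {}})"
proof -
  interpret atomic_monoid H by fact
  show ?thesis
    \<comment> \<open>The supremum of the union is the maximum of two suprema, which fold back to
      \<open>c_eq H\<close> and \<open>c_adj H\<close>; the last claim becomes
      \<open>c_mon_eq_max\<close>.\<close>
    unfolding Sup_union_distrib c_eq_eq_Sup_mu_eq_elt[symmetric] c_eq_eq_Sup_lengths[symmetric]
      c_adj_eq_Sup_mu_adj_elt[symmetric]
    by (simp add: mu_eq_elt_le_c_eq_elt mu_adj_elt_le_c_adj_elt c_eq_eq_mu_eq c_adj_eq_mu_adj
        c_mon_eq_max sup_max)
qed

end
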